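(* Let $k=(k_1,k_2)\in\mathbb{C}^2$ and let $\widetilde{\mathbb{D}}_{\mathrm{ns}}(k)$ be the commutant of $\widetilde{D}_k$ in $\mathbb{D}_{\mathfrak{R}}\otimes\mathbb{M}_2$. (i) The restriction $\gamma'_{\mathrm{ns}}(k):\widetilde{\mathbb{D}}_{\mathrm{ns}}(k)\to S(\mathfrak{h})\otimes\mathbb{M}_2$ is an injective algebra homomorphism. (ii) The image $\gamma'_{\mathrm{ns}}(k)(\widetilde{\mathbb{D}}_{\mathrm{ns}}(k))$ is contained in the upper triangular matrices. (iii) For $D\in\widetilde{\mathbb{D}}_{\mathrm{ns}}(k)$, the entry $\gamma'_{\mathrm{ns}}(k)(D)_{12}$ is determined by $\gamma'_{\mathrm{ns}}(k)(D)_{11}$ and $\gamma'_{\mathrm{ns}}(k)(D)_{22}$. The properties (i)–(iii) also hold for the restriction of $\gamma_{\mathrm{ns}}(k)$ to $\widetilde{\mathbb{D}}_{\mathrm{ns}}(k)$.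
   Context: Write $z=e^{\epsilon}$, so $e^{n\epsilon}=z^n$, and $\partial_\xi=z\,d/dz$ ($\partial_\xi e^{n\epsilon}=ne^{n\epsilon}$). Let $\mathfrak{h}=\mathbb{C}\xi$ with $\epsilon(\xi)=1$; $S(\mathfrak{h})=\mathbb{C}[\xi]$ is the algebra of polynomial functions on $\mathfrak{h}^*=\mathbb{C}\epsilon$ ($\xi$ evaluates at $c\epsilon$ to $c$). $\mathfrak{R}$ is the unital algebra generated by $(1-e^{-\epsilon})^{-1}$ and $(1-e^{-2\epsilon})^{-1}$, and $\mathbb{D}_{\mathfrak{R}}=\mathfrak{R}\otimes\mathbb{C}[\partial_\xi]$ is the algebra of differential operators with coefficients in $\mathfrak{R}$. $\mathbb{M}_2$ denotes complex $2\times2$ matrices. Put $\rho(k)=\frac12(k_1+2k_2)$ and $$\widetilde{D}_k=\begin{pmatrix}\partial_\xi+\frac{k_1}{1-e^{-\epsilon}}+\frac{2k_2}{1-e^{-2\epsilon}}-\rho(k)&-\frac{k_1}{1-e^{-\epsilon}}-\frac{2k_2}{1-e^{-2\epsilon}}\\-\frac{k_1}{1-e^{\epsilon}}-\frac{2k_2}{1-e^{2\epsilon}}&-\partial_\xi-\frac{k_1}{1-e^{-\epsilon}}-\frac{2k_2}{1-e^{-2\epsilon}}+\rho(k)\end{pmatrix}\in\mathbb{D}_{\mathfrak{R}}\otimes\mathbb{M}_2.$$ The scalar constant term map $\gamma'(k)$ and Harish-Chandra homomorphism $\gamma(k)$ are the unique algebra homomorphisms $\mathbb{D}_{\mathfrak{R}}\to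 S(\mathfrak{h})$ sending $(1-e^{-\epsilon})^{-1}$ and $(1-e^{-2\epsilon})^{-1}$ to $1$, with $\gamma'(k)(\partial_\xi)=\xi$ and $\gamma(k)(\partial_\xi)=\xi-\rho(k)$. Their matrix-valued versions are defined entrywise: $\gamma'_{\mathrm{ns}}(k)(D\otimes A)=\gamma'(k)(D)\otimes A$, $\gamma_{\mathrm{ns}}(k)(D\otimes A)=\gamma(k)(D)\otimes A$ for $D\otimes A\in\mathbb{D}_{\mathfrak{R}}\otimes\mathbb{M}_2$. *)

theory Defs
  imports
    "HOL-Analysis.Analysis"
    "HOL-Computational_Algebra.Formal_Laurent_Series"
begin

(* The Laurent series theory leaves this notation active; it clashes with vec_nth. *)
no_notation fps_nth (infixl \<open>$\<close> 75)

section \<open>The coefficient algebra\<close>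

text \<open>
  Rational functions in \<open>z = e^\<epsilon>\<close> are identified with their Laurent expansions at
  \<open>z = \<infinity>\<close>. Thus the indeterminate \<^const>\<open>fls_X\<close> stands for \<open>e^{-\<epsilon>} = 1 / z\<close>, and
  \<open>z d/dz = - (1/z) d/d(1/z)\<close>.
\<close>

definition expo :: "int \<Rightarrow> complex fls"
  where "expo n = fls_X powi (- n)"

definition del :: "complex fls \<Rightarrow> complex fls"
  where "del f = - fls_X * fls_deriv f"

lemma expo_0: "expo 0 = 1"
  by (simp add: expo_def)

lemma expo_add: "expo (m + n) = expo m * expo n"
  using power_int_add[of "fls_X :: complex fls" "- m" "- n"]
  by (simp add: expo_def del: fls_X_power_int)

lemma del_expo: "del (expo n) = of_int n * expo n"
  by (rule fls_eqI)
     (auto simp: del_def expo_def fls_X_times_conv_shift fls_of_int add_eq_0_iff simp flip: of_int_minus)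

inductive_set frakR :: "complex fls set" where
  const: "fls_const c \<in> frakR"
| gen1: "inverse (1 - expo (-1)) \<in> frakR"
| gen2: "inverse (1 - expo (-2)) \<in> frakR"
| add: "f \<in> frakR \<Longrightarrow> g \<in> frakR \<Longrightarrow> f + g \<in> frakR"
| mult: "f \<in> frakR \<Longrightarrow> g \<in> frakR \<Longrightarrow> f * g \<in> frakR"

lemma del_add: "del (f + g) = del f + del g"
  by (simp add: del_def algebra_simps)

lemma del_mult: "del (f * g) = del f * g + f * del g"
  by (simp add: del_def algebra_simps)

lemma del_const: "del (fls_const c) = 0"
  by (simp add: del_def)

lemma del_0: "del 0 = 0"
  by (simp add: del_def)

lemma frakR_0: "0 \<in> frakR"
  using frakR.const[of 0] by simp

lemma frakR_1: "1 \<in> frakR"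
  using frakR.const[of 1] by simp

lemma frakR_uminus: "f \<in> frakR \<Longrightarrow> - f \<in> frakR"
  using frakR.mult[OF frakR.const[of "-1"], of f] by (metis fls_const_1 fls_const_uminus mult_minus1)

lemma frakR_diff: "f \<in> frakR \<Longrightarrow> g \<in> frakR \<Longrightarrow> f - g \<in> frakR"
  using frakR.add[of f "- g"] frakR_uminus by simp

lemma expo_nz: "n \<noteq> 0 \<Longrightarrow> 1 - expo n \<noteq> 0"
proof
  assume n: "n \<noteq> 0" and "1 - expo n = 0"
  then have "fls_nth (expo n) 0 = fls_nth 1 0"
    by simp
  with n show False by (simp add: expo_def)
qed

lemma inverse_expo_uminus:
  assumes "n \<noteq> 0"
  shows "inverse (1 - expo n) = 1 - inverse (1 - expo (- n))"
proof -
  have e: "expo n * expo (- n) = 1"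
    using expo_add[of n "-n"] expo_0 by simp
  have a: "1 - expo n \<noteq> 0" and b: "1 - expo (- n) \<noteq> 0"
    using assms expo_nz[of n] expo_nz[of "- n"] by auto
  have "(1 - expo n) * (1 - inverse (1 - expo (- n))) = 1"
    using e b by (simp add: field_simps)
  then show ?thesis
    by (rule inverse_unique)
qed

lemma frakR_inverse_pos:
  "inverse (1 - expo 1) \<in> frakR" "inverse (1 - expo 2) \<in> frakR"
  using inverse_expo_uminus[of 1] inverse_expo_uminus[of 2] frakR.gen1 frakR.gen2 frakR_1
  by (simp_all add: frakR_diff)

lemma del_inverse:
  assumes "n \<noteq> 0"
  shows "del (inverse (1 - expo n))
    = of_int n * (inverse (1 - expo n) * inverse (1 - expo n) - inverse (1 - expo n))"
proof -
  define g where "g = 1 - expo n"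
  have nz: "g \<noteq> 0" unfolding g_def using assms by (rule expo_nz)
  have dg: "del g = of_int n * (g - 1)"
    using del_add[of g "expo n"] del_const[of 1] del_expo[of n]
    by (simp add: g_def algebra_simps eq_neg_iff_add_eq_0)
  have "0 = del (g * inverse g)"
    using nz del_const[of 1] by simp
  also have "\<dots> = of_int n * (g - 1) * inverse g + g * del (inverse g)"
    by (simp only: del_mult dg)
  finally have e: "g * del (inverse g) = - (of_int n * (g - 1) * inverse g)"
    by (metis add.commute eq_neg_iff_add_eq_0)
  have "del (inverse g) = inverse g * (g * del (inverse g))"
    using nz by simp
  also have "\<dots> = of_int n * (inverse g * inverse g - (g * inverse g) * inverse g)"
    unfolding e by algebra
  finally show ?thesis
    using nz by (simp add: g_def)
qed

lemma of_int_frakR: "of_int n \<in> frakR"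
  by (simp add: fls_of_int frakR.const)

lemma del_frakR: "f \<in> frakR \<Longrightarrow> del f \<in> frakR"
proof (induction rule: frakR.induct)
  case (const c)
  then show ?case by (simp add: del_const frakR_0)
next
  case gen1
  show ?case
    by (subst del_inverse) (simp, intro frakR.mult frakR_diff of_int_frakR frakR.intros)
next
  case gen2
  show ?case
    by (subst del_inverse) (simp, intro frakR.mult frakR_diff of_int_frakR frakR.intros)
next
  case (add f g)
  then show ?case by (simp add: del_add frakR.add)
next
  case (mult f g)
  then show ?case by (simp add: del_mult frakR.add frakR.mult)
qed


section \<open>Differential operators\<close>

text \<open>
  The operator \<open>\<Sum>\<^sub>i a\<^sub>i \<partial>\<^sup>i\<close> is encoded by the polynomial with coefficients \<open>a\<^sub>i\<close>, and
  composition comes from \<open>\<partial> \<circ> b \<partial>\<^sup>j = b \<partial>\<^sup>j\<^sup>+\<^sup>1 + del b \<partial>\<^sup>j\<close>; it is not the product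
  of polynomials.
\<close>

definition dmul :: "complex fls poly \<Rightarrow> complex fls poly"
  where "dmul q = pCons 0 q + map_poly del q"

definition op_mult :: "complex fls poly \<Rightarrow> complex fls poly \<Rightarrow> complex fls poly"
  where "op_mult p q = (\<Sum>i\<le>degree p. smult (coeff p i) ((dmul ^^ i) q))"

lemma dmul_add: "dmul (p + q) = dmul p + dmul q"
  by (rule poly_eqI) (auto simp: dmul_def coeff_map_poly del_0 del_add coeff_pCons split: nat.split)

lemma dmul_0 [simp]: "dmul 0 = 0"
  by (simp add: dmul_def)

lemma dmul_smult: "dmul (smult a q) = smult (del a) q + smult a (dmul q)"
  by (rule poly_eqI)
     (auto simp: dmul_def coeff_map_poly del_0 del_mult coeff_pCons algebra_simps split: nat.split)

lemma dmul_pCons: "dmul (pCons a p) = pCons (del a) [:a:] + pCons 0 (dmul p)"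
  by (rule poly_eqI)
     (auto simp: dmul_def coeff_map_poly del_0 coeff_pCons algebra_simps split: nat.split)

lemma funpow_dmul_add: "(dmul ^^ i) (p + q) = (dmul ^^ i) p + (dmul ^^ i) q"
  by (induction i) (simp_all add: dmul_add)

lemma op_mult_bound:
  "degree p \<le> n \<Longrightarrow> op_mult p q = (\<Sum>i\<le>n. smult (coeff p i) ((dmul ^^ i) q))"
  unfolding op_mult_def by (rule sum.mono_neutral_left) (auto simp: coeff_eq_0)

lemma op_mult_0 [simp]: "op_mult 0 q = 0"
  by (simp add: op_mult_def)

lemma op_mult_0_right [simp]: "op_mult p 0 = 0"
proof -
  have "(dmul ^^ i) 0 = 0" for i by (induction i) simp_all
  then show ?thesis by (simp add: op_mult_def)
qed

lemma op_mult_pCons: "op_mult (pCons a p) q = smult a q + op_mult p (dmul q)"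
proof -
  have "op_mult (pCons a p) q
      = (\<Sum>i\<le>Suc (degree p). smult (coeff (pCons a p) i) ((dmul ^^ i) q))"
    by (rule op_mult_bound) (simp add: degree_pCons_le)
  also have "\<dots> = smult a q + (\<Sum>i\<le>degree p. smult (coeff p i) ((dmul ^^ Suc i) q))"
    by (subst sum.atMost_Suc_shift) simp
  finally show ?thesis
    by (simp add: op_mult_def funpow_swap1)
qed

lemma op_mult_add_right: "op_mult p (q + r) = op_mult p q + op_mult p r"
  by (simp add: op_mult_def funpow_dmul_add smult_add_right sum.distrib)

lemma op_mult_add_left: "op_mult (p + q) r = op_mult p r + op_mult q r"
proof -
  define n where "n = max (degree p) (degree q)"
  have "degree (p + q) \<le> n" "degree p \<le> n" "degree q \<le> n"
    by (auto simp: n_def degree_add_le_max)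
  then show ?thesis
    by (simp add: op_mult_bound[where n = n] smult_add_left sum.distrib)
qed

lemma op_mult_smult: "op_mult (smult a p) q = smult a (op_mult p q)"
  by (induction p arbitrary: q) (simp_all add: op_mult_pCons smult_add_right)

lemma op_mult_dmul: "op_mult (dmul p) q = dmul (op_mult p q)"
  by (induction p arbitrary: q)
     (simp_all add: dmul_pCons op_mult_add_left op_mult_pCons dmul_add dmul_smult)

lemma op_mult_assoc: "op_mult (op_mult p q) r = op_mult p (op_mult q r)"
  by (induction p arbitrary: q)
     (simp_all add: op_mult_pCons op_mult_add_left op_mult_smult op_mult_dmul)

lemma op_mult_1: "op_mult 1 q = q"
  by (simp add: one_pCons op_mult_pCons)

lemma op_mult_1_right: "op_mult p 1 = p"
proof -
  have m: "(dmul ^^ i) 1 = monom 1 i" for i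
  proof (induction i)
    case (Suc i)
    have "map_poly del (monom 1 i) = 0"
      using del_const[of 1] by (intro poly_eqI) (simp add: coeff_map_poly del_0)
    with Suc show ?case by (simp add: dmul_def monom_Suc)
  qed (simp add: monom_0 one_pCons)
  show ?thesis
    by (simp add: op_mult_def m smult_monom poly_as_sum_of_monoms)
qed

definition op_carrier :: "complex fls poly set"
  where "op_carrier = {p. \<forall>i. coeff p i \<in> frakR}"

lemma op_carrier_pCons: "pCons a p \<in> op_carrier \<longleftrightarrow> a \<in> frakR \<and> p \<in> op_carrier"
  by (auto simp: op_carrier_def coeff_pCons split: nat.splits)

lemma op_carrier_0: "0 \<in> op_carrier"
  by (simp add: op_carrier_def frakR_0)

lemma op_carrier_1: "1 \<in> op_carrier"
  by (simp add: one_pCons op_carrier_pCons op_carrier_0 frakR_1)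

lemma op_carrier_add: "p \<in> op_carrier \<Longrightarrow> q \<in> op_carrier \<Longrightarrow> p + q \<in> op_carrier"
  by (simp add: op_carrier_def frakR.add)

lemma op_carrier_uminus: "p \<in> op_carrier \<Longrightarrow> - p \<in> op_carrier"
  by (simp add: op_carrier_def frakR_uminus)

lemma op_carrier_smult: "a \<in> frakR \<Longrightarrow> p \<in> op_carrier \<Longrightarrow> smult a p \<in> op_carrier"
  by (simp add: op_carrier_def frakR.mult)

lemma op_carrier_dmul: "p \<in> op_carrier \<Longrightarrow> dmul p \<in> op_carrier"
  by (auto simp: op_carrier_def dmul_def coeff_map_poly coeff_pCons frakR_0 del_0
      intro: frakR.add del_frakR split: nat.split)

lemma op_carrier_mult: "p \<in> op_carrier \<Longrightarrow> q \<in> op_carrier \<Longrightarrow> op_mult p q \<in> op_carrier"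
  by (induction p arbitrary: q)
     (simp_all add: op_carrier_pCons op_mult_pCons op_carrier_add op_carrier_smult
       op_carrier_dmul op_carrier_0)

typedef diffop = op_carrier
  using op_carrier_0 by blast

setup_lifting type_definition_diffop

instantiation diffop :: ring_1
begin

lift_definition zero_diffop :: diffop is 0 by (rule op_carrier_0)
lift_definition one_diffop :: diffop is 1 by (rule op_carrier_1)
lift_definition plus_diffop :: "diffop \<Rightarrow> diffop \<Rightarrow> diffop" is "(+)" by (rule op_carrier_add)
lift_definition uminus_diffop :: "diffop \<Rightarrow> diffop" is uminus by (rule op_carrier_uminus)
lift_definition minus_diffop :: "diffop \<Rightarrow> diffop \<Rightarrow> diffop" is "(-)"
  using op_carrier_add op_carrier_uminus by fastforce
lift_definition times_diffop :: "diffop \<Rightarrow> diffop \<Rightarrow> diffop" is op_mult by (rule op_carrier_mult)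

instance
  by standard
     (transfer; simp add: op_mult_assoc op_mult_add_left op_mult_add_right op_mult_1 op_mult_1_right)+

end

lift_definition dscale :: "complex \<Rightarrow> diffop \<Rightarrow> diffop" is "\<lambda>c. smult (fls_const c)"
  by (simp add: op_carrier_smult frakR.const)

lift_definition d_xi :: diffop is "[:0, 1:]"
  by (simp add: op_carrier_pCons op_carrier_0 frakR_0 frakR_1)

text \<open>Multiplication operators; the default value 0 outside \<^const>\<open>frakR\<close> is never used.\<close>

lift_definition mult_op :: "complex fls \<Rightarrow> diffop" is "\<lambda>f. if f \<in> frakR then [:f:] else 0"
  by (simp add: op_carrier_pCons op_carrier_0)

definition rec_exp :: "int \<Rightarrow> diffop"
  where "rec_exp n = mult_op (inverse (1 - expo n))"

lemma Rep_rec_exp: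
  "n \<in> {-2, -1, 1, 2} \<Longrightarrow> Rep_diffop (rec_exp n) = [:inverse (1 - expo n):]"
  using frakR.gen1 frakR.gen2 frakR_inverse_pos by (auto simp: rec_exp_def mult_op.rep_eq)

lemma mult_op_add: "f \<in> frakR \<Longrightarrow> g \<in> frakR \<Longrightarrow> mult_op (f + g) = mult_op f + mult_op g"
  by transfer (simp add: frakR.add)

lemma mult_op_mult: "f \<in> frakR \<Longrightarrow> g \<in> frakR \<Longrightarrow> mult_op (f * g) = mult_op f * mult_op g"
  by transfer (simp add: frakR.mult op_mult_pCons)

lemma mult_op_const: "mult_op (fls_const c) = dscale c 1"
  by transfer (simp add: frakR.const one_pCons)

lemma leibniz: "f \<in> frakR \<Longrightarrow> d_xi * mult_op f = mult_op f * d_xi + mult_op (del f)"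
  by transfer (simp add: del_frakR op_mult_pCons dmul_pCons)


section \<open>Complex algebras and their homomorphisms\<close>

definition alg_hom_on ::
  "'a::ab_group_add set \<Rightarrow> (complex \<Rightarrow> 'a \<Rightarrow> 'a) \<Rightarrow> ('a \<Rightarrow> 'a \<Rightarrow> 'a) \<Rightarrow> 'a
    \<Rightarrow> (complex \<Rightarrow> 'b \<Rightarrow> 'b) \<Rightarrow> ('b \<Rightarrow> 'b \<Rightarrow> 'b) \<Rightarrow> 'b::ab_group_add \<Rightarrow> ('a \<Rightarrow> 'b) \<Rightarrow> bool"
  where "alg_hom_on A sc mul one sc' mul' one' f \<longleftrightarrow>
    \<comment> \<open>the domain is a unital subalgebra\<close>
    one \<in> A \<and> (\<forall>x\<in>A. \<forall>y\<in>A. x + y \<in> A \<and> mul x y \<in> A) \<and> (\<forall>c. \<forall>x\<in>A. sc c x \<in> A) \<and>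
    f one = one' \<and>
    (\<forall>x\<in>A. \<forall>y\<in>A. f (x + y) = f x + f y \<and> f (mul x y) = mul' (f x) (f y)) \<and>
    (\<forall>c. \<forall>x\<in>A. f (sc c x) = sc' c (f x))"

definition mat_scale :: "(complex \<Rightarrow> 'a \<Rightarrow> 'a) \<Rightarrow> complex \<Rightarrow> 'a ^ 2 ^ 2 \<Rightarrow> 'a ^ 2 ^ 2"
  where "mat_scale sc c A = (\<chi> i j. sc c (A $ i $ j))"


section \<open>Constant terms and the Harish-Chandra homomorphism\<close>

definition rho :: "complex \<times> complex \<Rightarrow> complex"
  where "rho k = (fst k + 2 * snd k) / 2"

text \<open>\<open>S(\<hh>) = \<complex>[\<xi>]\<close> is \<^typ>\<open>complex poly\<close> with indeterminate \<open>\<xi> = [:0, 1:]\<close>.\<close>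

definition is_hc_hom :: "complex poly \<Rightarrow> (diffop \<Rightarrow> complex poly) \<Rightarrow> bool"
  where "is_hc_hom P g \<longleftrightarrow>
    alg_hom_on UNIV dscale (*) 1 smult (*) 1 g \<and>
    g (rec_exp (-1)) = 1 \<and> g (rec_exp (-2)) = 1 \<and> g d_xi = P"

definition gamma' :: "complex \<times> complex \<Rightarrow> diffop \<Rightarrow> complex poly"
  where "gamma' k = (THE g. is_hc_hom [:0, 1:] g)"

definition gamma :: "complex \<times> complex \<Rightarrow> diffop \<Rightarrow> complex poly"
  where "gamma k = (THE g. is_hc_hom [:- rho k, 1:] g)"

text \<open>Both descriptions are legitimate: a unique such homomorphism exists.\<close>

lemma expo_neg: "expo (- int n) = fls_X ^ n"
  by (simp add: expo_def fls_X_power_conv_shift_1)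

lemma inverse_gen:
  assumes "n > 0"
  shows "inverse (1 - expo (- int n)) = fps_to_fls (inverse (1 - fps_X ^ n))"
proof -
  have "1 - expo (- int n) = fps_to_fls (1 - fps_X ^ n)"
    by (simp add: expo_neg fps_to_fls_power)
  moreover have "fps_to_fls (1 - fps_X ^ n :: complex fps) * fps_to_fls (inverse (1 - fps_X ^ n)) = 1"
    using assms by (simp add: inverse_mult_eq_1' del: fps_to_fls_minus flip: fls_times_fps_to_fls)
  ultimately show ?thesis
    by (metis inverse_unique)
qed

lemma inverse_gens_nth:
  "fls_nth (inverse (1 - expo (-1))) 0 = 1" "fls_nth (inverse (1 - expo (-2))) 0 = 1"
  using inverse_gen[of 1] inverse_gen[of 2] by simp_all

lemma frakR_regular:
  assumes "f \<in> frakR"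
  obtains F where "f = fps_to_fls F"
proof -
  have "\<exists>F. f = fps_to_fls F"
    using assms
  proof (induction rule: frakR.induct)
    case (const c)
    then show ?case by (metis fps_const_to_fls)
  next
    case gen1
    then show ?case using inverse_gen[of 1] by auto
  next
    case gen2
    then show ?case using inverse_gen[of 2] by auto
  next
    case (add f g)
    then show ?case by (metis fps_to_fls_plus)
  next
    case (mult f g)
    then show ?case by (metis fls_times_fps_to_fls)
  qed
  then show ?thesis using that by blast
qed

lemma frakR_nth_mult:
  assumes "f \<in> frakR" "g \<in> frakR"
  shows "fls_nth (f * g) 0 = fls_nth f 0 * fls_nth g 0"
proof -
  obtain F G where "f = fps_to_fls F" "g = fps_to_fls G"
    using assms frakR_regular by metis
  then show ?thesis by (simp flip: fls_times_fps_to_fls)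
qed

lemma del_nth_0: "fls_nth (del f) 0 = 0"
  by (simp add: del_def fls_X_times_conv_shift)

definition hc_eval :: "complex poly \<Rightarrow> complex fls poly \<Rightarrow> complex poly"
  where "hc_eval P p = pcompose (map_poly (\<lambda>f. fls_nth f 0) p) P"

lemma hc_eval_0: "hc_eval P 0 = 0"
  by (simp add: hc_eval_def)

lemma hc_eval_pCons: "hc_eval P (pCons a p) = [:fls_nth a 0:] + P * hc_eval P p"
  by (cases "a = 0 \<and> p = 0") (auto simp: hc_eval_def map_poly_pCons pcompose_pCons)

lemma hc_eval_add: "hc_eval P (p + q) = hc_eval P p + hc_eval P q"
proof -
  have "map_poly (\<lambda>f. fls_nth f 0) (p + q)
      = map_poly (\<lambda>f. fls_nth f 0) p + map_poly (\<lambda>f. fls_nth f 0) q"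
    by (rule poly_eqI) (simp add: coeff_map_poly)
  then show ?thesis by (simp add: hc_eval_def pcompose_add)
qed

lemma hc_eval_smult:
  assumes "a \<in> frakR" "q \<in> op_carrier"
  shows "hc_eval P (smult a q) = smult (fls_nth a 0) (hc_eval P q)"
  using assms(2)
  by (induction q rule: pCons_induct)
     (simp_all add: hc_eval_0 hc_eval_pCons op_carrier_pCons frakR_nth_mult assms(1)
       smult_add_right)

lemma hc_eval_dmul: "hc_eval P (dmul q) = P * hc_eval P q"
proof -
  have "map_poly (\<lambda>f. fls_nth f 0) (map_poly del q) = 0"
    by (rule poly_eqI) (simp add: coeff_map_poly del_0 del_nth_0)
  then have "hc_eval P (map_poly del q) = 0"
    by (simp add: hc_eval_def)
  then show ?thesis
    by (simp add: dmul_def hc_eval_add hc_eval_pCons)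
qed

lemma hc_eval_mult:
  "p \<in> op_carrier \<Longrightarrow> q \<in> op_carrier \<Longrightarrow> hc_eval P (op_mult p q) = hc_eval P p * hc_eval P q"
  by (induction p arbitrary: q)
     (simp_all add: op_mult_pCons hc_eval_0 hc_eval_add hc_eval_pCons hc_eval_smult
       op_carrier_pCons op_carrier_dmul hc_eval_dmul algebra_simps)

lift_definition hc_map :: "complex poly \<Rightarrow> diffop \<Rightarrow> complex poly" is hc_eval .

lemma is_hc_hom_hc_map: "is_hc_hom P (hc_map P)"
proof -
  have "hc_map P 1 = 1"
    by transfer (simp add: one_pCons hc_eval_pCons hc_eval_0 del: one_poly_eq_simps)
  moreover have "hc_map P (x + y) = hc_map P x + hc_map P y" for x y
    by transfer (simp add: hc_eval_add)
  moreover have "hc_map P (x * y) = hc_map P x * hc_map P y" for x y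
    by transfer (simp add: hc_eval_mult)
  moreover have "hc_map P (dscale c x) = smult c (hc_map P x)" for c x
    by transfer (simp add: hc_eval_smult frakR.const)
  moreover have "hc_map P (rec_exp (-1)) = 1" "hc_map P (rec_exp (-2)) = 1"
    by (simp_all add: hc_map.rep_eq Rep_rec_exp hc_eval_pCons hc_eval_0 inverse_gens_nth one_pCons)
  moreover have "hc_map P d_xi = P"
    by transfer (simp add: hc_eval_pCons hc_eval_0 del: one_poly_eq_simps)
  ultimately show ?thesis
    by (simp add: is_hc_hom_def alg_hom_on_def)
qed

lemma is_hc_hom_unique:
  assumes "is_hc_hom P g"
  shows "g = hc_map P"
proof
  have g_add: "g (x + y) = g x + g y" and g_mult: "g (x * y) = g x * g y"
    and scale: "g (dscale c x) = smult c (g x)" and one: "g 1 = 1"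
    and gens: "g (rec_exp (-1)) = 1" "g (rec_exp (-2)) = 1" "g d_xi = P" for x y c
    using assms by (simp_all add: is_hc_hom_def alg_hom_on_def)
  have coeffs: "g (mult_op f) = [:fls_nth f 0:]" if "f \<in> frakR" for f
    using that
  proof (induction rule: frakR.induct)
    case (const c)
    then show ?case by (simp add: mult_op_const scale one one_pCons)
  next
    case gen1
    then show ?case using gens by (simp add: rec_exp_def inverse_gens_nth one_pCons)
  next
    case gen2
    then show ?case using gens by (simp add: rec_exp_def inverse_gens_nth one_pCons)
  next
    case (add f g)
    then show ?case by (simp add: mult_op_add g_add)
  next
    case (mult f g)
    then show ?case by (simp add: mult_op_mult g_mult frakR_nth_mult)
  qed
  have shift: "op_mult p [:0, 1:] = pCons 0 p" for p
  proof -
    have "op_mult p [:0, 1:] = op_mult p (dmul 1)"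
      using del_const[of 1] by (simp add: dmul_pCons one_pCons)
    also have "\<dots> = op_mult (pCons 0 p) 1"
      by (simp add: op_mult_pCons)
    finally show ?thesis by (simp add: op_mult_1_right)
  qed
  have "p \<in> op_carrier \<Longrightarrow> g (Abs_diffop p) = hc_eval P p" for p
  proof (induction p)
    case 0
    have "g 0 = 0" using g_add[of 0 0] by simp
    then show ?case by (simp add: hc_eval_0 flip: zero_diffop_def)
  next
    case (pCons a p)
    then have a: "a \<in> frakR" and p: "p \<in> op_carrier" by (simp_all add: op_carrier_pCons)
    have "Abs_diffop (pCons a p) = mult_op a + Abs_diffop p * d_xi"
      by (rule Rep_diffop_inject[THEN iffD1])
         (use a p pCons.prems in \<open>simp add: Abs_diffop_inverse plus_diffop.rep_eq times_diffop.rep_eq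
           mult_op.rep_eq d_xi.rep_eq shift\<close>)
    with a p pCons.IH show ?case
      by (simp add: g_add g_mult coeffs gens hc_eval_pCons mult.commute)
  qed
  then show "g x = hc_map P x" for x
    by (metis Rep_diffop Rep_diffop_inverse hc_map.rep_eq)
qed

lemma ex1_is_hc_hom: "\<exists>!g. is_hc_hom P g"
  using is_hc_hom_hc_map is_hc_hom_unique by blast

definition gamma_ns' :: "complex \<times> complex \<Rightarrow> diffop ^ 2 ^ 2 \<Rightarrow> complex poly ^ 2 ^ 2"
  where "gamma_ns' k D = (\<chi> i j. gamma' k (D $ i $ j))"

definition gamma_ns :: "complex \<times> complex \<Rightarrow> diffop ^ 2 ^ 2 \<Rightarrow> complex poly ^ 2 ^ 2"
  where "gamma_ns k D = (\<chi> i j. gamma k (D $ i $ j))"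


section \<open>The operator and its commutant\<close>

text \<open>\<open>rec_exp n\<close> is \<open>1 / (1 - e^{n\<epsilon>})\<close>. Matrices are multiplied with \<open>**\<close>, since
  \<open>*\<close> is entrywise on vector types.\<close>

definition D_tilde :: "complex \<times> complex \<Rightarrow> diffop ^ 2 ^ 2"
  where "D_tilde k = (let k1 = fst k; k2 = snd k in
    vector [
      vector [d_xi + dscale k1 (rec_exp (-1)) + dscale (2 * k2) (rec_exp (-2)) - dscale (rho k) 1,
              - dscale k1 (rec_exp (-1)) - dscale (2 * k2) (rec_exp (-2))],
      vector [- dscale k1 (rec_exp 1) - dscale (2 * k2) (rec_exp 2),
              - d_xi - dscale k1 (rec_exp (-1)) - dscale (2 * k2) (rec_exp (-2)) + dscale (rho k) 1]])"

definition commutant :: "'a::semiring_1 ^ 'n ^ 'n \<Rightarrow> ('a ^ 'n ^ 'n) set"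
  where "commutant A = {B. B ** A = A ** B}"

definition D_ns :: "complex \<times> complex \<Rightarrow> (diffop ^ 2 ^ 2) set"
  where "D_ns k = commutant (D_tilde k)"

definition upper_triangular :: "('a::zero ^ 2 ^ 2) set"
  where "upper_triangular = {A. A $ 2 $ 1 = 0}"

end

theory Submission
  imports Defs
begin

text \<open>
  Put \<open>x = e\<^sup>-\<^sup>\<epsilon>\<close>. Every coefficient in \<^const>\<open>frakR\<close> is a power series in \<open>x\<close>, so a
  differential operator expands as \<open>D = \<Sum>\<^sub>m x\<^sup>m D\<^sub>m(\<partial>)\<close> with polynomials \<open>D\<^sub>m\<close>, it is
  determined by them, and the constant term map is \<open>D \<mapsto> D\<^sub>0(\<xi>)\<close>. Since
  \<open>p(\<partial>) \<circ> x\<^sup>m = x\<^sup>m p(\<partial> - m)\<close>, the lowest term of a product is easy to compute: if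
  \<open>D\<^sub>j = 0\<close> for all \<open>j < m\<close>, then \<open>(D E)\<^sub>m = D\<^sub>m(\<xi>) E\<^sub>0(\<xi>)\<close> and
  \<open>(E D)\<^sub>m = E\<^sub>0(\<xi> - m) D\<^sub>m(\<xi>)\<close>.

  Let \<open>s = \<xi> + \<rho>(k)\<close>. The constant term of \<^term>\<open>D_tilde k\<close> is the matrix with rows
  \<open>(s, - 2 \<rho>(k))\<close> and \<open>(0, - s)\<close>. Thus, for \<open>D\<close> in the commutant whose terms below \<open>x\<^sup>m\<close>
  vanish, comparing the coefficients of \<open>x\<^sup>m\<close> in \<open>D \<cdot> D_tilde k = D_tilde k \<cdot> D\<close> gives
  \<open>(2 s - m) c = 0\<close>, \<open>m a = - 2 \<rho>(k) c\<close>, \<open>m d = - 2 \<rho>(k) c\<close> and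
  \<open>(2 s - m) b = 2 \<rho>(k) (d - a)\<close> for the entries \<open>a, b, c, d\<close> of \<open>D\<^sub>m\<close>
  (lemma \<open>lowest_term_equations\<close>).

  For \<open>m = 0\<close> these say that \<open>c = 0\<close> and that \<open>s b = \<rho>(k) (d - a)\<close>, which give parts (ii) and
  (iii), because \<open>s\<close> is a nonzero polynomial for every \<open>k\<close>. For \<open>m > 0\<close> they force
  \<open>a = b = c = d = 0\<close>. Hence an element of the commutant with \<open>D\<^sub>0 = 0\<close> has \<open>D\<^sub>m = 0\<close> for all
  \<open>m\<close>, by induction, which is the injectivity in (i). Finally the Harish-Chandra homomorphism
  is the constant term map followed by the automorphism \<open>\<xi> \<mapsto> \<xi> - \<rho>(k)\<close> of \<open>\<complex>[\<xi>]\<close>, so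
  it has the same properties.
\<close>

section \<open>Expansion in powers of \<open>e\<^sup>-\<^sup>\<epsilon>\<close>\<close>

definition expansion_coeff_raw :: "nat \<Rightarrow> complex fls poly \<Rightarrow> complex poly"
  where "expansion_coeff_raw m p = map_poly (\<lambda>f. fls_nth f (int m)) p"

lemma coeff_expansion_coeff_raw:
  "coeff (expansion_coeff_raw m p) i = fls_nth (coeff p i) (int m)"
  by (simp add: expansion_coeff_raw_def coeff_map_poly)

lemma expansion_coeff_raw_0 [simp]: "expansion_coeff_raw m 0 = 0"
  by (simp add: expansion_coeff_raw_def)

lemma expansion_coeff_raw_pCons:
  "expansion_coeff_raw m (pCons a p) = pCons (fls_nth a (int m)) (expansion_coeff_raw m p)"
  by (rule poly_eqI) (simp add: coeff_expansion_coeff_raw coeff_pCons split: nat.split)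

lemma expansion_coeff_raw_add:
  "expansion_coeff_raw m (p + q) = expansion_coeff_raw m p + expansion_coeff_raw m q"
  by (rule poly_eqI) (simp add: coeff_expansion_coeff_raw)

lemma del_nth: "fls_nth (del f) n = - of_int n * fls_nth f n"
  by (simp add: del_def fls_X_times_conv_shift)

text \<open>This is the commutation rule \<open>\<partial> \<circ> x\<^sup>m = x\<^sup>m (\<partial> - m)\<close>, which comes from
  \<open>del x\<^sup>m = - m x\<^sup>m\<close>.\<close>

lemma expansion_coeff_raw_dmul:
  "expansion_coeff_raw m (dmul q) = [:- of_nat m, 1:] * expansion_coeff_raw m q"
  by (rule poly_eqI)
     (auto simp: coeff_expansion_coeff_raw dmul_def coeff_map_poly del_0 del_nth coeff_pCons
       split: nat.split)

lemma frakR_nth_mult_lowest: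
  assumes "f \<in> frakR" "g \<in> frakR" and low: "\<And>j. j < m \<Longrightarrow> fls_nth g (int j) = 0"
  shows "fls_nth (f * g) (int m) = fls_nth f 0 * fls_nth g (int m)"
proof -
  obtain F G where F: "f = fps_to_fls F" and G: "g = fps_to_fls G"
    using assms(1,2) frakR_regular by metis
  have "fps_nth (F * G) m = (\<Sum>i=0..m. fps_nth F i * fps_nth G (m - i))"
    by (rule fps_mult_nth)
  also have "\<dots> = (\<Sum>i\<in>{0}. fps_nth F i * fps_nth G (m - i))"
    using low by (intro sum.mono_neutral_right) (auto simp: G)
  finally show ?thesis
    by (simp add: F G flip: fls_times_fps_to_fls)
qed

lemma expansion_coeff_raw_smult:
  assumes "a \<in> frakR" "q \<in> op_carrier" and low: "\<And>j. j < m \<Longrightarrow> expansion_coeff_raw j q = 0"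
  shows "expansion_coeff_raw m (smult a q) = smult (fls_nth a 0) (expansion_coeff_raw m q)"
proof (rule poly_eqI)
  fix i
  have "fls_nth (coeff q i) (int j) = 0" if "j < m" for j
    using low[OF that] by (metis coeff_expansion_coeff_raw coeff_0)
  then show "coeff (expansion_coeff_raw m (smult a q)) i
      = coeff (smult (fls_nth a 0) (expansion_coeff_raw m q)) i"
    using assms(1,2) by (simp add: coeff_expansion_coeff_raw frakR_nth_mult_lowest op_carrier_def)
qed

lemma expansion_coeff_raw_smult_lowest:
  assumes "a \<in> frakR" "q \<in> op_carrier" and low: "\<And>j. j < m \<Longrightarrow> fls_nth a (int j) = 0"
  shows "expansion_coeff_raw m (smult a q) = smult (fls_nth a (int m)) (expansion_coeff_raw 0 q)"
proof (rule poly_eqI)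
  fix i
  have "coeff q i \<in> frakR" using assms(2) by (simp add: op_carrier_def)
  from frakR_nth_mult_lowest[OF this assms(1) low]
  show "coeff (expansion_coeff_raw m (smult a q)) i
      = coeff (smult (fls_nth a (int m)) (expansion_coeff_raw 0 q)) i"
    by (simp add: coeff_expansion_coeff_raw mult.commute)
qed

lemma expansion_coeff_raw_mult_right:
  assumes "p \<in> op_carrier" "q \<in> op_carrier" "\<And>j. j < m \<Longrightarrow> expansion_coeff_raw j q = 0"
  shows "expansion_coeff_raw m (op_mult p q)
    = hc_eval [:- of_nat m, 1:] p * expansion_coeff_raw m q"
  using assms
proof (induction p arbitrary: q rule: pCons_induct)
  case 0
  then show ?case by (simp add: hc_eval_0)
next
  case (pCons a p)
  have a: "a \<in> frakR" and p: "p \<in> op_carrier"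
    using pCons.prems(1) by (simp_all add: op_carrier_pCons)
  have IH: "expansion_coeff_raw m (op_mult p (dmul q))
      = hc_eval [:- of_nat m, 1:] p * expansion_coeff_raw m (dmul q)"
    using p pCons.prems(2,3)
    by (intro pCons.IH) (simp_all add: op_carrier_dmul expansion_coeff_raw_dmul)
  have "expansion_coeff_raw m (op_mult (pCons a p) q)
      = smult (fls_nth a 0) (expansion_coeff_raw m q)
        + hc_eval [:- of_nat m, 1:] p * ([:- of_nat m, 1:] * expansion_coeff_raw m q)"
    by (simp only: op_mult_pCons expansion_coeff_raw_add IH expansion_coeff_raw_dmul
        expansion_coeff_raw_smult[OF a pCons.prems(2,3)])
  also have "\<dots> = hc_eval [:- of_nat m, 1:] (pCons a p) * expansion_coeff_raw m q"
    by (simp add: hc_eval_pCons algebra_simps)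
  finally show ?case .
qed

lemma expansion_coeff_raw_mult_left:
  assumes "p \<in> op_carrier" "q \<in> op_carrier" "\<And>j. j < m \<Longrightarrow> expansion_coeff_raw j p = 0"
  shows "expansion_coeff_raw m (op_mult p q) = expansion_coeff_raw m p * expansion_coeff_raw 0 q"
  using assms
proof (induction p arbitrary: q rule: pCons_induct)
  case 0
  then show ?case by simp
next
  case (pCons a p)
  have a: "a \<in> frakR" and p: "p \<in> op_carrier"
    using pCons.prems(1) by (simp_all add: op_carrier_pCons)
  have low: "fls_nth a (int j) = 0 \<and> expansion_coeff_raw j p = 0" if "j < m" for j
    using pCons.prems(3)[OF that] by (simp add: expansion_coeff_raw_pCons)
  have IH: "expansion_coeff_raw m (op_mult p (dmul q))
      = expansion_coeff_raw m p * expansion_coeff_raw 0 (dmul q)"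
    using p pCons.prems(2) low by (intro pCons.IH) (simp_all add: op_carrier_dmul)
  show ?case
    using expansion_coeff_raw_smult_lowest[OF a pCons.prems(2)] low IH
    by (simp add: op_mult_pCons expansion_coeff_raw_add expansion_coeff_raw_dmul
        expansion_coeff_raw_pCons)
qed

lemma expansion_coeff_raw_eq_0D:
  assumes "p \<in> op_carrier" "\<And>m. expansion_coeff_raw m p = 0"
  shows "p = 0"
proof (rule poly_eqI)
  fix i
  obtain F where F: "coeff p i = fps_to_fls F"
    using assms(1) frakR_regular by (auto simp: op_carrier_def)
  have "fps_nth F m = 0" for m
    using assms(2)[of m] coeff_expansion_coeff_raw[of m p i] by (simp add: F)
  then have "F = 0" by (simp add: fps_ext)
  then show "coeff p i = coeff 0 i" by (simp add: F)
qed

lemma expansion_coeff_raw_0_eq_hc_eval: "expansion_coeff_raw 0 p = hc_eval [:0, 1:] p"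
  by (simp add: expansion_coeff_raw_def hc_eval_def pcompose_idR)

lift_definition expansion_coeff :: "nat \<Rightarrow> diffop \<Rightarrow> complex poly" is expansion_coeff_raw .

lemma expansion_coeff_add: "expansion_coeff m (D + E) = expansion_coeff m D + expansion_coeff m E"
  by transfer (rule expansion_coeff_raw_add)

lemma expansion_coeff_0_eq_hc_map: "expansion_coeff 0 = hc_map [:0, 1:]"
  by (rule ext, transfer) (rule expansion_coeff_raw_0_eq_hc_eval)

text \<open>If \<open>D\<close> starts at \<open>x\<^sup>m\<close>, then only \<open>x\<^sup>m D\<^sub>m(\<partial>)\<close> and \<open>E\<^sub>0(\<partial>)\<close> contribute to \<open>x\<^sup>m\<close> in
  \<open>D E\<close> and \<open>E D\<close>, and moving \<open>E\<^sub>0(\<partial>)\<close> past \<open>x\<^sup>m\<close> shifts its argument by \<open>- m\<close>.\<close>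

lemma expansion_coeff_mult_left:
  "(\<And>j. j < m \<Longrightarrow> expansion_coeff j D = 0)
    \<Longrightarrow> expansion_coeff m (D * E) = expansion_coeff m D * hc_map [:0, 1:] E"
  unfolding expansion_coeff_0_eq_hc_map[symmetric]
  by transfer (rule expansion_coeff_raw_mult_left)

lemma expansion_coeff_mult_right:
  "(\<And>j. j < m \<Longrightarrow> expansion_coeff j D = 0)
    \<Longrightarrow> expansion_coeff m (E * D) = hc_map [:- of_nat m, 1:] E * expansion_coeff m D"
  by transfer (rule expansion_coeff_raw_mult_right)

lemma expansion_coeff_eq_0D: "(\<And>m. expansion_coeff m D = 0) \<Longrightarrow> D = 0"
  by transfer (rule expansion_coeff_raw_eq_0D)


section \<open>Homomorphisms on commutants\<close>

lemma dscale_add: "dscale c (D + E) = dscale c D + dscale c E"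
  by transfer (simp add: smult_add_right)

lemma dscale_mult_left: "dscale c D * E = dscale c (D * E)"
  by transfer (rule op_mult_smult)

lemma dscale_mult_right: "D * dscale c E = dscale c (D * E)"
proof (transfer fixing: c)
  show "op_mult p (smult (fls_const c) q) = smult (fls_const c) (op_mult p q)" for p q
    by (induction p arbitrary: q)
       (simp_all add: op_mult_pCons dmul_smult del_const smult_add_right mult.commute)
qed

lemma hc_map_hom:
  "hc_map P 1 = 1" "hc_map P (D + E) = hc_map P D + hc_map P E"
  "hc_map P (D * E) = hc_map P D * hc_map P E" "hc_map P (dscale c D) = smult c (hc_map P D)"
  "hc_map P (rec_exp (-1)) = 1" "hc_map P (rec_exp (-2)) = 1" "hc_map P d_xi = P"
  using is_hc_hom_hc_map[of P] by (simp_all add: is_hc_hom_def alg_hom_on_def)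

lemma hc_map_0: "hc_map P 0 = 0"
  using hc_map_hom(2)[of P 0 0] by simp

lemma hc_map_uminus: "hc_map P (- D) = - hc_map P D"
  using hc_map_hom(2)[of P D "- D"] by (simp add: hc_map_0 eq_neg_iff_add_eq_0 add.commute)

lemma hc_map_diff: "hc_map P (D - E) = hc_map P D - hc_map P E"
  using hc_map_hom(2)[of P D "- E"] by (simp add: hc_map_uminus)

lemma mat2_mult_entry: "(A ** B) $ i $ j = A $ i $ 1 * B $ 1 $ j + A $ i $ 2 * B $ 2 $ j"
  for A B :: "'a::semiring_1 ^ 2 ^ 2"
  by (simp add: matrix_matrix_mult_def sum_2)

lemma alg_hom_on_commutant:
  "alg_hom_on (commutant A) (mat_scale dscale) (**) (mat 1) (mat_scale smult) (**) (mat 1)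
    (\<lambda>D. \<chi> i j. hc_map P (D $ i $ j))" for A :: "diffop ^ 2 ^ 2"
proof -
  have add: "(X + Y) ** Z = X ** Z + Y ** Z" "Z ** (X + Y) = Z ** X + Z ** Y"
    for X Y Z :: "diffop ^ 2 ^ 2"
    by (simp_all add: vec_eq_iff mat2_mult_entry algebra_simps)
  have scale: "mat_scale dscale c X ** Y = mat_scale dscale c (X ** Y)"
    "X ** mat_scale dscale c Y = mat_scale dscale c (X ** Y)" for c and X Y :: "diffop ^ 2 ^ 2"
    by (simp_all add: vec_eq_iff mat2_mult_entry mat_scale_def dscale_mult_left dscale_mult_right
        dscale_add)
  let ?h = "\<lambda>D::diffop ^ 2 ^ 2. \<chi> i j. hc_map P (D $ i $ j)"
  have "(X ** Y) ** A = A ** (X ** Y)" if "X ** A = A ** X" "Y ** A = A ** Y" for X Y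
    using that by (metis matrix_mul_assoc)
  moreover have "?h (mat 1) = mat 1" "?h (X + Y) = ?h X + ?h Y" "?h (X ** Y) = ?h X ** ?h Y"
    "?h (mat_scale dscale c X) = mat_scale smult c (?h X)" for X Y c
    by (simp_all add: vec_eq_iff mat2_mult_entry mat_def mat_scale_def hc_map_hom hc_map_0)
  ultimately show ?thesis
    by (simp add: alg_hom_on_def commutant_def add scale)
qed

lemma D_ns_diff:
  assumes "D \<in> D_ns k" "E \<in> D_ns k"
  shows "D - E \<in> D_ns k"
proof -
  have "(X - Y) ** Z = X ** Z - Y ** Z" "Z ** (X - Y) = Z ** X - Z ** Y"
    for X Y Z :: "diffop ^ 2 ^ 2"
    by (simp_all add: vec_eq_iff mat2_mult_entry algebra_simps)
  with assms show ?thesis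
    by (simp add: D_ns_def commutant_def)
qed


section \<open>Lowest terms of commuting operators\<close>

text \<open>This is why the constant term of \<^term>\<open>D_tilde k\<close> is upper triangular: its lower left
  entry is built from \<open>1 / (1 - z\<^sup>n)\<close> with \<open>n > 0\<close>, and
  \<open>1 / (1 - z\<^sup>n) = 1 - 1 / (1 - z\<^sup>-\<^sup>n)\<close>, where the last quotient is mapped to \<open>1\<close>.\<close>

lemma hc_map_rec_exp_pos: "hc_map P (rec_exp 1) = 0" "hc_map P (rec_exp 2) = 0"
proof -
  have "rec_exp n = 1 - rec_exp (- n)" if "n \<in> {1, 2}" for n
  proof -
    have n: "n \<in> {-2, -1, 1, 2}" "- n \<in> {-2, -1, 1, 2}" "n \<noteq> 0" using that by auto
    show ?thesis
      using inverse_expo_uminus[OF n(3)]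
      by (simp add: Rep_rec_exp[OF n(1)] Rep_rec_exp[OF n(2)] minus_diffop.rep_eq
          one_diffop.rep_eq one_pCons flip: Rep_diffop_inject)
  qed
  from this[of 1] this[of 2] show "hc_map P (rec_exp 1) = 0" "hc_map P (rec_exp 2) = 0"
    by (simp_all add: hc_map_diff hc_map_hom)
qed

lemma hc_map_D_tilde:
  "hc_map P (D_tilde k $ 1 $ 1) = P + [:rho k:]"
  "hc_map P (D_tilde k $ 1 $ 2) = - [:2 * rho k:]"
  "hc_map P (D_tilde k $ 2 $ 1) = 0"
  "hc_map P (D_tilde k $ 2 $ 2) = - (P + [:rho k:])"
proof -
  have "[:fst k:] + [:2 * snd k:] = [:2 * rho k:]" "[:2 * rho k:] = [:rho k:] + [:rho k:]"
    by (simp_all add: rho_def)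
  then show "hc_map P (D_tilde k $ 1 $ 1) = P + [:rho k:]"
    "hc_map P (D_tilde k $ 1 $ 2) = - [:2 * rho k:]"
    "hc_map P (D_tilde k $ 2 $ 1) = 0"
    "hc_map P (D_tilde k $ 2 $ 2) = - (P + [:rho k:])"
    by (simp_all add: D_tilde_def Let_def vector_2 hc_map_hom hc_map_diff hc_map_uminus
        hc_map_rec_exp_pos smult_one algebra_simps)
qed

text \<open>These are the entries of \<open>D\<^sub>m(\<xi>) T(\<xi>) = T(\<xi> - m) D\<^sub>m(\<xi>)\<close>, where \<open>T\<close> is the constant term
  of \<^term>\<open>D_tilde k\<close>.\<close>

lemma lowest_term_equations:
  assumes "D \<in> D_ns k" and low: "\<And>j i l. j < m \<Longrightarrow> expansion_coeff j (D $ i $ l) = 0"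
  defines "C \<equiv> \<lambda>i j. expansion_coeff m (D $ i $ j)"
  shows "[:2 * rho k - of_nat m, 2:] * C 2 1 = 0"
    and "smult (of_nat m) (C 1 1) = - smult (2 * rho k) (C 2 1)"
    and "smult (of_nat m) (C 2 2) = - smult (2 * rho k) (C 2 1)"
    and "[:2 * rho k - of_nat m, 2:] * C 1 2 = smult (2 * rho k) (C 2 2 - C 1 1)"
proof -
  let ?T = "\<lambda>P i j. hc_map P (D_tilde k $ i $ j)"
  have eq: "C i 1 * ?T [:0, 1:] 1 j + C i 2 * ?T [:0, 1:] 2 j
      = ?T [:- of_nat m, 1:] i 1 * C 1 j + ?T [:- of_nat m, 1:] i 2 * C 2 j" for i j
  proof -
    have "D ** D_tilde k = D_tilde k ** D"
      using assms(1) by (simp add: D_ns_def commutant_def)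
    then have "D $ i $ 1 * D_tilde k $ 1 $ j + D $ i $ 2 * D_tilde k $ 2 $ j
        = D_tilde k $ i $ 1 * D $ 1 $ j + D_tilde k $ i $ 2 * D $ 2 $ j"
      by (metis mat2_mult_entry)
    from arg_cong[OF this, of "expansion_coeff m"] show ?thesis
      by (simp add: C_def expansion_coeff_add expansion_coeff_mult_left
          expansion_coeff_mult_right low)
  qed
  define a b r where "a = [:0, 1:] + [:rho k:]" and "b = [:- of_nat m, 1:] + [:rho k:]"
    and "r = [:2 * rho k:]"
  have eqs: "C 1 1 * a = b * C 1 1 - r * C 2 1" "- (C 1 1 * r) - C 1 2 * a = b * C 1 2 - r * C 2 2"
    "C 2 1 * a = - (b * C 2 1)" "- (C 2 1 * r) - C 2 2 * a = - (b * C 2 2)"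
    using eq[of 1 1] eq[of 1 2] eq[of 2 1] eq[of 2 2]
    by (simp_all only: hc_map_D_tilde a_def[symmetric] b_def[symmetric] r_def[symmetric]
        mult_zero_left mult_zero_right add_0_left add_0_right mult_minus_left mult_minus_right
        add_uminus_conv_diff diff_0)
  have sum: "a + b = [:2 * rho k - of_nat m, 2:]" and diff: "a - b = [:of_nat m:]"
    by (simp_all add: a_def b_def)
  have "(a + b) * C 2 1 = 0" "(a - b) * C 1 1 = - (r * C 2 1)" "(a - b) * C 2 2 = - (r * C 2 1)"
    "(a + b) * C 1 2 = r * (C 2 2 - C 1 1)"
    using eqs by algebra+
  then show "[:2 * rho k - of_nat m, 2:] * C 2 1 = 0"
    "smult (of_nat m) (C 1 1) = - smult (2 * rho k) (C 2 1)"
    "smult (of_nat m) (C 2 2) = - smult (2 * rho k) (C 2 1)"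
    "[:2 * rho k - of_nat m, 2:] * C 1 2 = smult (2 * rho k) (C 2 2 - C 1 1)"
    unfolding sum diff by (simp_all only: r_def) simp_all
qed

text \<open>A nonzero element without constant term would have a lowest nonzero term \<open>x\<^sup>m D\<^sub>m(\<partial>)\<close> with \<open>m > 0\<close>, but then all
  entries of \<open>D\<^sub>m\<close> vanish by the previous equations.\<close>

lemma D_ns_eq_0:
  assumes D: "D \<in> D_ns k" and const: "\<And>i j. hc_map [:0, 1:] (D $ i $ j) = 0"
  shows "D = 0"
proof -
  have "\<forall>i j. expansion_coeff m (D $ i $ j) = 0" for m
  proof (induction m rule: less_induct)
    case (less m)
    show ?case
    proof (cases "m = 0")
      case True
      then show ?thesis by (simp add: expansion_coeff_0_eq_hc_map const)
    next
      case False
      from less have low: "\<And>j i l. j < m \<Longrightarrow> expansion_coeff j (D $ i $ l) = 0" by blast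
      note eqs = lowest_term_equations[OF D low, of m]
      have "expansion_coeff m (D $ 2 $ 1) = 0"
        using eqs(1) by (simp only: mult_eq_0_iff) simp
      moreover from this have "expansion_coeff m (D $ 1 $ 1) = 0" "expansion_coeff m (D $ 2 $ 2) = 0"
        using eqs(2,3) False by simp_all
      moreover from this have "expansion_coeff m (D $ 1 $ 2) = 0"
        using eqs(4) by (simp only: mult_eq_0_iff diff_self smult_0_right) simp
      ultimately show ?thesis by (simp add: forall_2)
    qed
  qed
  then show ?thesis
    by (simp add: vec_eq_iff expansion_coeff_eq_0D)
qed


section \<open>The constant term map and the Harish-Chandra homomorphism\<close>

lemma gamma'_eq_hc_map: "gamma' k = hc_map [:0, 1:]"
  unfolding gamma'_def by (rule the_equality) (rule is_hc_hom_hc_map, erule is_hc_hom_unique)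

lemma gamma_eq_hc_map: "gamma k = hc_map [:- rho k, 1:]"
  unfolding gamma_def by (rule the_equality) (rule is_hc_hom_hc_map, erule is_hc_hom_unique)

text \<open>The shift \<open>\<xi> \<mapsto> \<xi> - \<rho>(k)\<close> is invertible, so \<open>\<gamma>(k)\<close> identifies the same operators as
  \<open>\<gamma>'(k)\<close>. Injectivity, triangularity and the dependence of the upper right
  entry on the diagonal carry over through this equivalence.\<close>

lemma gamma_eq_iff: "gamma k D = gamma k E \<longleftrightarrow> gamma' k D = gamma' k E"
proof -
  have shift: "gamma k D = pcompose (gamma' k D) [:- rho k, 1:]" for D
    unfolding gamma'_eq_hc_map gamma_eq_hc_map
    by transfer (simp add: hc_eval_def pcompose_idR)
  have unshift: "gamma' k D = pcompose (gamma k D) [:rho k, 1:]" for D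
    by (simp add: shift pcompose_idR pcompose_pCons flip: pcompose_assoc)
  show ?thesis
    by (metis shift unshift)
qed

lemma gamma_ns_eq_iff: "gamma_ns k D = gamma_ns k E \<longleftrightarrow> gamma_ns' k D = gamma_ns' k E"
  by (simp add: gamma_ns_def gamma_ns'_def vec_eq_iff gamma_eq_iff)

lemma inj_on_gamma_ns': "inj_on (gamma_ns' k) (D_ns k)"
proof (rule inj_onI)
  fix D E assume D: "D \<in> D_ns k" "E \<in> D_ns k" and eq: "gamma_ns' k D = gamma_ns' k E"
  have "hc_map [:0, 1:] ((D - E) $ i $ j) = 0" for i j
    using eq by (simp add: gamma_ns'_def vec_eq_iff gamma'_eq_hc_map hc_map_diff)
  from D_ns_eq_0[OF D_ns_diff[OF D] this] show "D = E" by simp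
qed

lemma gamma_ns'_entry_21:
  assumes "D \<in> D_ns k"
  shows "gamma_ns' k D $ 2 $ 1 = 0"
  using lowest_term_equations(1)[OF assms, of 0]
  by (simp only: mult_eq_0_iff)
     (simp add: gamma_ns'_def gamma'_eq_hc_map expansion_coeff_0_eq_hc_map)

lemma gamma_ns'_entry_12:
  assumes "D \<in> D_ns k"
  shows "[:2 * rho k, 2:] * gamma_ns' k D $ 1 $ 2
    = smult (2 * rho k) (gamma_ns' k D $ 2 $ 2 - gamma_ns' k D $ 1 $ 1)"
  using lowest_term_equations(4)[OF assms, of 0]
  by (simp add: gamma_ns'_def gamma'_eq_hc_map expansion_coeff_0_eq_hc_map)

lemma gamma_ns'_entry_12_determined:
  assumes "D \<in> D_ns k" "E \<in> D_ns k"
    and "gamma_ns' k D $ 1 $ 1 = gamma_ns' k E $ 1 $ 1"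
    and "gamma_ns' k D $ 2 $ 2 = gamma_ns' k E $ 2 $ 2"
  shows "gamma_ns' k D $ 1 $ 2 = gamma_ns' k E $ 1 $ 2"
proof -
  have "[:2 * rho k, 2:] * gamma_ns' k D $ 1 $ 2 = [:2 * rho k, 2:] * gamma_ns' k E $ 1 $ 2"
    using gamma_ns'_entry_12[OF assms(1)] gamma_ns'_entry_12[OF assms(2)] assms(3,4) by simp
  then show ?thesis
    by (subst (asm) mult_cancel_left) simp
qed

theorem proposition6p8:
  fixes k :: "complex \<times> complex"
  shows
    "alg_hom_on (D_ns k) (mat_scale dscale) (**) (mat 1)
       (mat_scale smult) (**) (mat 1) (gamma_ns' k)
     \<and> inj_on (gamma_ns' k) (D_ns k)
     \<and> gamma_ns' k ` D_ns k \<subseteq> upper_triangular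
     \<and> (\<forall>D\<in>D_ns k. \<forall>E\<in>D_ns k.
          gamma_ns' k D $ 1 $ 1 = gamma_ns' k E $ 1 $ 1 \<longrightarrow>
          gamma_ns' k D $ 2 $ 2 = gamma_ns' k E $ 2 $ 2 \<longrightarrow>
          gamma_ns' k D $ 1 $ 2 = gamma_ns' k E $ 1 $ 2)
     \<and> alg_hom_on (D_ns k) (mat_scale dscale) (**) (mat 1)
       (mat_scale smult) (**) (mat 1) (gamma_ns k)
     \<and> inj_on (gamma_ns k) (D_ns k)
     \<and> gamma_ns k ` D_ns k \<subseteq> upper_triangular
     \<and> (\<forall>D\<in>D_ns k. \<forall>E\<in>D_ns k.
          gamma_ns k D $ 1 $ 1 = gamma_ns k E $ 1 $ 1 \<longrightarrow>
          gamma_ns k D $ 2 $ 2 = gamma_ns k E $ 2 $ 2 \<longrightarrow>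
          gamma_ns k D $ 1 $ 2 = gamma_ns k E $ 1 $ 2)"
proof -
  have hom': "alg_hom_on (D_ns k) (mat_scale dscale) (**) (mat 1)
      (mat_scale smult) (**) (mat 1) (gamma_ns' k)"
    using alg_hom_on_commutant[of "D_tilde k" "[:0, 1:]"]
    unfolding D_ns_def gamma_ns'_def[abs_def] gamma'_eq_hc_map .
  have hom: "alg_hom_on (D_ns k) (mat_scale dscale) (**) (mat 1)
      (mat_scale smult) (**) (mat 1) (gamma_ns k)"
    using alg_hom_on_commutant[of "D_tilde k" "[:- rho k, 1:]"]
    unfolding D_ns_def gamma_ns_def[abs_def] gamma_eq_hc_map .
  have inj: "inj_on (gamma_ns k) (D_ns k)"
    using inj_on_gamma_ns' by (simp add: inj_on_def gamma_ns_eq_iff)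
  have upper': "gamma_ns' k ` D_ns k \<subseteq> upper_triangular"
    by (simp add: image_subset_iff upper_triangular_def gamma_ns'_entry_21)
  have "gamma k D = 0 \<longleftrightarrow> gamma' k D = 0" for D
    using gamma_eq_iff[of k D 0] by (simp add: gamma_eq_hc_map gamma'_eq_hc_map hc_map_0)
  then have upper: "gamma_ns k ` D_ns k \<subseteq> upper_triangular"
    using upper' by (simp add: image_subset_iff upper_triangular_def gamma_ns_def gamma_ns'_def)
  have entry: "gamma_ns k D $ i $ j = gamma_ns k E $ i $ j
      \<longleftrightarrow> gamma_ns' k D $ i $ j = gamma_ns' k E $ i $ j" for D E i j
    by (simp add: gamma_ns_def gamma_ns'_def gamma_eq_iff)
  show ?thesis
    unfolding entry
    using hom' hom inj_on_gamma_ns' inj upper' upper gamma_ns'_entry_12_determined by blast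
qed

end
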